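(* (i) Let $T$ be a tree. Then, identifying each block of $T$ with the unique edge it contains, $\mathrm{CBP}(T)=\mathrm{CSP}(T)$. (ii) Let $G$ be a connected Eulerian cactus graph. Then $$\mathrm{ESP}_p(G)=\mathrm{CBP}(G)\cong\mathrm{TECSP}(G)=\mathrm{ESP}(G),$$ where $\cong$ denotes unimodular equivalence (and the blocks of $G$ are exactly its cycles, which identifies the coordinate index sets of $\mathrm{ESP}_p(G)$ and $\mathrm{CBP}(G)$).
   Context: Graphs are finite, simple and undirected. A connected graph is 2-connected if it has at least three vertices and remains connected after deleting any single vertex. A bridge is an edge whose deletion increases the number of connected components. A block of $G$ is a maximal 2-connected subgraph of $G$ or a bridge together with its two end vertices; $\mathcal{B}$ denotes the set of blocks of $G$. For $\mathcal{A}\subseteq\mathcal{B}$ let $G[\mathcal{A}]=\bigcup_{B\in\mathcal{A}}B$ (the empty graph counts as connected), and let $\chi^{\mathcal{A}}\in\{0,1\}^{\mathcal{B}}$ be the incidence vector of $\mathcal{A}$. The connected blocks polytope is $\mathrm{CBP}(G)=\mathrm{conv}\{\chi^{\mathcal{A}}\mid \mathcal{A}\subseteq\mathcal{B},\ G[\mathcal{A}]\text{ connected}\}\subseteq\mathbb{R}^{\mathcal{B}}$. For a subgraph $H\subseteq G$ let $\chi^{E(H)}\in\{0,1\}^{E(G)}$ be the incidence vector of its edge set. A graph is Eulerian if it is connected except possibly for isolated vertices and every vertex has even degree. A graph is 2-edge-connected if it is connected and contains no bridges. A cactus graph is a graph in which any two distinct cycles have at most one vertex in common. Define - $\mathrm{CSP}(G)=\mathrm{conv}\{\chi^{E(H)}\mid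 H\subseteq G\text{ connected}\}$ (connected subgraph polytope), - $\mathrm{ESP}(G)=\mathrm{conv}\{\chi^{E(H)}\mid H\subseteq G\text{ Eulerian}\}$ (Eulerian subgraph polytope), - $\mathrm{TECSP}(G)=\mathrm{conv}\{\chi^{E(H)}\mid H\subseteq G\text{ 2-edge-connected}\}$ (2-edge-connected subgraph polytope), - for an Eulerian cactus graph $G$ with set of cycles $\mathcal{C}$, $\mathrm{ESP}_p(G)=\mathrm{conv}\{\chi^{\mathcal{C}(H)}\mid H\subseteq G\text{ Eulerian}\}\subseteq\mathbb{R}^{\mathcal{C}}$, where $\chi^{\mathcal{C}(H)}\in\{0,1\}^{\mathcal{C}}$ is the incidence vector of the set $\mathcal{C}(H)$ of cycles of $H$. Two lattice polytopes $P\subseteq\mathbb{R}^m$, $Q\subseteq\mathbb{R}^n$ are unimodular equivalent if there is an affine isomorphism between their affine hulls mapping $\mathrm{aff}(P)\cap\mathbb{Z}^m$ bijectively onto $\mathrm{aff}(Q)\cap\mathbb{Z}^n$ and $P$ onto $Q$. *)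

theory Defs
  imports "HOL-Analysis.Analysis" "HOL-Analysis.Finite_Function_Topology"
begin

section \<open>Finite simple undirected graphs\<close>

datatype 'v graph = Graph (verts: "'v set") (edges: "'v set set")

definition is_graph :: "'v graph \<Rightarrow> bool" where
  "is_graph G \<longleftrightarrow> finite (verts G) \<and> (\<forall>e\<in>edges G. e \<subseteq> verts G \<and> card e = 2)"

definition subgraph :: "'v graph \<Rightarrow> 'v graph \<Rightarrow> bool" where
  "subgraph H G \<longleftrightarrow> is_graph H \<and> is_graph G \<and> verts H \<subseteq> verts G \<and> edges H \<subseteq> edges G"

definition adj :: "'v graph \<Rightarrow> ('v \<times> 'v) set" where
  "adj G = {(u, v). {u, v} \<in> edges G}"

text \<open>The empty graph counts as connected.\<close>

definition graph_connected :: "'v graph \<Rightarrow> bool" where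
  "graph_connected G \<longleftrightarrow> (\<forall>u\<in>verts G. \<forall>v\<in>verts G. (u, v) \<in> (adj G)\<^sup>*)"

definition graph_components :: "'v graph \<Rightarrow> 'v set set" where
  "graph_components G = verts G // {(u, v). u \<in> verts G \<and> v \<in> verts G \<and> (u, v) \<in> (adj G)\<^sup>*}"

definition degree :: "'v graph \<Rightarrow> 'v \<Rightarrow> nat" where
  "degree G v = card {e \<in> edges G. v \<in> e}"

definition delete_vertex :: "'v graph \<Rightarrow> 'v \<Rightarrow> 'v graph" where
  "delete_vertex G v = Graph (verts G - {v}) {e \<in> edges G. v \<notin> e}"

definition delete_edge :: "'v graph \<Rightarrow> 'v set \<Rightarrow> 'v graph" where
  "delete_edge G e = Graph (verts G) (edges G - {e})"

definition delete_isolated :: "'v graph \<Rightarrow> 'v graph" where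
  "delete_isolated G = Graph {v \<in> verts G. degree G v \<noteq> 0} (edges G)"

definition graph_Union :: "'v graph set \<Rightarrow> 'v graph" where
  "graph_Union A = Graph (\<Union>B\<in>A. verts B) (\<Union>B\<in>A. edges B)"

definition two_connected :: "'v graph \<Rightarrow> bool" where
  "two_connected G \<longleftrightarrow> graph_connected G \<and> card (verts G) \<ge> 3 \<and>
     (\<forall>v\<in>verts G. graph_connected (delete_vertex G v))"

definition bridge :: "'v graph \<Rightarrow> 'v set \<Rightarrow> bool" where
  "bridge G e \<longleftrightarrow> e \<in> edges G \<and>
     card (graph_components (delete_edge G e)) > card (graph_components G)"

definition two_edge_connected :: "'v graph \<Rightarrow> bool" where
  "two_edge_connected G \<longleftrightarrow> graph_connected G \<and> (\<forall>e. \<not> bridge G e)"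

text \<open>In the second part, an edge \<open>e\<close> is a two-element set, so \<open>Graph e {e}\<close> is that edge
  together with its two end vertices.\<close>

definition blocks :: "'v graph \<Rightarrow> 'v graph set" where
  "blocks G =
     {B. subgraph B G \<and> two_connected B \<and>
         (\<forall>K. subgraph K G \<and> two_connected K \<and> subgraph B K \<longrightarrow> K = B)}
     \<union> {Graph e {e} |e. bridge G e}"

definition is_cycle :: "'v graph \<Rightarrow> bool" where
  "is_cycle C \<longleftrightarrow> (\<exists>vs. distinct vs \<and> length vs \<ge> 3 \<and> verts C = set vs \<and>
     edges C = {{vs ! i, vs ! (Suc i mod length vs)} |i. i < length vs})"

definition cycles :: "'v graph \<Rightarrow> 'v graph set" where
  "cycles G = {C. subgraph C G \<and> is_cycle C}"

definition tree :: "'v graph \<Rightarrow> bool" where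
  "tree G \<longleftrightarrow> is_graph G \<and> graph_connected G \<and> cycles G = {}"

definition cactus :: "'v graph \<Rightarrow> bool" where
  "cactus G \<longleftrightarrow> is_graph G \<and>
     (\<forall>C\<in>cycles G. \<forall>D\<in>cycles G. C \<noteq> D \<longrightarrow> card (verts C \<inter> verts D) \<le> 1)"

definition eulerian :: "'v graph \<Rightarrow> bool" where
  "eulerian G \<longleftrightarrow> graph_connected (delete_isolated G) \<and> (\<forall>v\<in>verts G. even (degree G v))"


section \<open>Polytopes with coordinates indexed by a finite set\<close>

text \<open>For a finite index set \<open>I\<close>, the space \<open>\<real>\<^sup>I\<close> is rendered as the subspace of those finitely
  supported functions \<open>x\<close> with \<open>Poly_Mapping.keys x \<subseteq> I\<close>.\<close>

definition incidence_vector :: "'i set \<Rightarrow> ('i, real) poly_mapping" where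
  "incidence_vector A = (\<Sum>a\<in>A. Poly_Mapping.single a 1)"

definition lattice_points :: "'i set \<Rightarrow> ('i, real) poly_mapping set" where
  "lattice_points I = {x. Poly_Mapping.keys x \<subseteq> I \<and> (\<forall>i\<in>I. Poly_Mapping.lookup x i \<in> \<int>)}"

definition lattice_polytope :: "'i set \<Rightarrow> ('i, real) poly_mapping set \<Rightarrow> bool" where
  "lattice_polytope I P \<longleftrightarrow> (\<exists>V. finite V \<and> V \<subseteq> lattice_points I \<and> P = convex hull V)"

text \<open>For \<open>f\<close> injective on the finite set \<open>I\<close>, the isomorphism from \<open>\<real>\<^sup>I\<close> to
  \<open>\<real>\<^bsup>f ` I\<^esup>\<close> that renames each coordinate \<open>i\<close> to \<open>f i\<close>.\<close>

definition relabel :: "('i \<Rightarrow> 'j) \<Rightarrow> 'i set \<Rightarrow> ('i, real) poly_mapping \<Rightarrow> ('j, real) poly_mapping" where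
  "relabel f I x = (\<Sum>i\<in>I. Poly_Mapping.single (f i) (Poly_Mapping.lookup x i))"

definition affine_isomorphism ::
  "('a::real_vector \<Rightarrow> 'b::real_vector) \<Rightarrow> 'a set \<Rightarrow> 'b set \<Rightarrow> bool" where
  "affine_isomorphism f S T \<longleftrightarrow> bij_betw f S T \<and>
     (\<forall>x\<in>S. \<forall>y\<in>S. \<forall>t::real.
        f ((1 - t) *\<^sub>R x + t *\<^sub>R y) = (1 - t) *\<^sub>R f x + t *\<^sub>R f y)"

definition unimodular_equivalent ::
  "'i set \<Rightarrow> ('i, real) poly_mapping set \<Rightarrow> 'j set \<Rightarrow> ('j, real) poly_mapping set \<Rightarrow> bool" where
  "unimodular_equivalent I P J Q \<longleftrightarrow>
     finite I \<and> finite J \<and> lattice_polytope I P \<and> lattice_polytope J Q \<and>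
     (\<exists>f. affine_isomorphism f (affine hull P) (affine hull Q) \<and>
          bij_betw f (affine hull P \<inter> lattice_points I) (affine hull Q \<inter> lattice_points J) \<and>
          f ` P = Q)"


section \<open>Polytopes of a graph\<close>

definition CBP :: "'v graph \<Rightarrow> ('v graph, real) poly_mapping set" where
  "CBP G = convex hull {incidence_vector A |A. A \<subseteq> blocks G \<and> graph_connected (graph_Union A)}"

definition CSP :: "'v graph \<Rightarrow> ('v set, real) poly_mapping set" where
  "CSP G = convex hull {incidence_vector (edges H) |H. subgraph H G \<and> graph_connected H}"

definition ESP :: "'v graph \<Rightarrow> ('v set, real) poly_mapping set" where
  "ESP G = convex hull {incidence_vector (edges H) |H. subgraph H G \<and> eulerian H}"

definition TECSP :: "'v graph \<Rightarrow> ('v set, real) poly_mapping set" where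
  "TECSP G = convex hull {incidence_vector (edges H) |H. subgraph H G \<and> two_edge_connected H}"

text \<open>Intended for Eulerian cactus graphs only.\<close>

definition ESP\<^sub>p :: "'v graph \<Rightarrow> ('v graph, real) poly_mapping set" where
  "ESP\<^sub>p G = convex hull {incidence_vector (cycles H) |H. subgraph H G \<and> eulerian H}"

end

theory Submission
  imports Defs
begin

text \<open>
  An edge is a bridge iff it lies on no cycle, and a 2-connected graph contains a cycle. So the blocks
  of a tree are its edges. A graph with all degrees even has no bridge, and conversely, in a cactus
  distinct cycles are edge-disjoint, so a bridgeless subgraph is an edge-disjoint union of
  cycles and has even degrees. Hence a set of edges spans an Eulerian subgraph of a cactus iff it is
  the edge set of a 2-edge-connected one, and Eulerian subgraphs correspond to sets of cycles with
  connected union. Since any two adjacent edges of a 2-connected graph lie on a common cycle,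
  the blocks of a bridgeless cactus are its cycles. The unimodular equivalence is the linear map
  sending the unit vector of a cycle to the incidence vector of its edge set; the supports of these
  images are disjoint and nonempty, so the map is injective and preserves integrality both ways.
\<close>

section \<open>Paths and connectivity\<close>

text \<open>Recursion on the vertex list, instead of the indices of \<open>is_cycle\<close>, makes
  walks accessible to induction.\<close>

fun path_edges :: "'v list \<Rightarrow> 'v set set" where
  "path_edges (x # y # zs) = insert {x, y} (path_edges (y # zs))"
| "path_edges _ = {}"

text \<open>A two-vertex list closes up to a single edge and a one-vertex list to the degenerate set
  \<open>{v}\<close>; hence the bound \<open>length vs \<ge> 3\<close> wherever cycles are
  formed.\<close>

definition closed_path_edges :: "'v list \<Rightarrow> 'v set set" where
  "closed_path_edges vs = insert {last vs, hd vs} (path_edges vs)"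

lemma path_edges_Cons: "xs \<noteq> [] \<Longrightarrow> path_edges (x # xs) = insert {x, hd xs} (path_edges xs)"
  by (cases xs) auto

lemma path_edges_append_subset: "path_edges xs \<subseteq> path_edges (xs @ ys)"
  by (induction xs rule: path_edges.induct) (auto simp: path_edges_Cons)

lemma path_edges_snoc: "xs \<noteq> [] \<Longrightarrow> path_edges (xs @ [x]) = insert {last xs, x} (path_edges xs)"
  by (induction xs rule: path_edges.induct) auto

lemma path_edges_subset: "e \<in> path_edges xs \<Longrightarrow> e \<subseteq> set xs"
  by (induction xs rule: path_edges.induct) auto

lemma path_edges_eq_nth: "path_edges vs = {{vs ! i, vs ! Suc i} |i. Suc i < length vs}"
proof (induction vs rule: path_edges.induct)
  case (1 x y zs)
  have "{{(x # y # zs) ! i, (x # y # zs) ! Suc i} |i. Suc i < length (x # y # zs)} =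
    insert {x, y} {{(y # zs) ! i, (y # zs) ! Suc i} |i. Suc i < length (y # zs)}" (is "?L = ?R")
  proof
    show "?L \<subseteq> ?R"
    proof
      fix e assume "e \<in> ?L"
      then obtain i where "e = {(x # y # zs) ! i, (x # y # zs) ! Suc i}" "Suc i < length (x # y # zs)"
        by auto
      then show "e \<in> ?R" by (cases i) auto
    qed
    show "?R \<subseteq> ?L"
    proof
      fix e assume "e \<in> ?R"
      then consider "e = {x, y}"
        | i where "e = {(y # zs) ! i, (y # zs) ! Suc i}" "Suc i < length (y # zs)"
        by auto
      then show "e \<in> ?L"
      proof cases
        case 1
        then show ?thesis by (auto intro!: exI[of _ 0])
      next
        case 2
        then show ?thesis by (auto intro!: exI[of _ "Suc i"])
      qed
    qed
  qed
  with 1 show ?case by simp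
qed auto

lemma closed_path_edges_eq_nth:
  assumes "vs \<noteq> []"
  shows "closed_path_edges vs = {{vs ! i, vs ! (Suc i mod length vs)} |i. i < length vs}" (is "_ = ?R")
proof
  obtain n where n: "length vs = Suc n" using assms by (cases vs) auto
  have l: "last vs = vs ! n" "hd vs = vs ! 0" using assms n by (simp_all add: last_conv_nth hd_conv_nth)
  show "closed_path_edges vs \<subseteq> ?R"
  proof
    fix e assume "e \<in> closed_path_edges vs"
    then consider "e = {vs ! n, vs ! 0}" | i where "e = {vs ! i, vs ! Suc i}" "Suc i < length vs"
      unfolding closed_path_edges_def path_edges_eq_nth l by auto
    then show "e \<in> ?R"
    proof cases
      case 1
      then show ?thesis using n by (auto intro!: exI[of _ n])
    next
      case 2
      then show ?thesis by (auto intro!: exI[of _ i])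
    qed
  qed
  show "?R \<subseteq> closed_path_edges vs"
  proof
    fix e assume "e \<in> ?R"
    then obtain i where i: "e = {vs ! i, vs ! (Suc i mod length vs)}" "i < length vs" by auto
    show "e \<in> closed_path_edges vs"
    proof (cases "i = n")
      case True
      then show ?thesis using i n l by (simp add: closed_path_edges_def)
    next
      case False
      then show ?thesis using i n by (auto simp: closed_path_edges_def path_edges_eq_nth)
    qed
  qed
qed

lemma closed_path_edges_rotate1: "length vs \<ge> 2 \<Longrightarrow> closed_path_edges (rotate1 vs) = closed_path_edges vs"
  by (cases vs; cases "tl vs")
    (auto simp: closed_path_edges_def path_edges_Cons path_edges_snoc insert_commute)

lemma closed_path_edges_rotate:
  "length vs \<ge> 2 \<Longrightarrow> closed_path_edges (rotate n vs) = closed_path_edges vs"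
  by (induction n) (simp_all add: closed_path_edges_rotate1)

lemma is_cycle_iff:
  "is_cycle C \<longleftrightarrow> (\<exists>vs. distinct vs \<and> length vs \<ge> 3 \<and> C = Graph (set vs) (closed_path_edges vs))"
proof -
  have "verts C = set vs \<and> edges C = {{vs ! i, vs ! (Suc i mod length vs)} |i. i < length vs} \<longleftrightarrow>
      C = Graph (set vs) (closed_path_edges vs)" if "length vs \<ge> 3" for vs
  proof -
    have "vs \<noteq> []" using that by auto
    then show ?thesis by (cases C) (simp add: closed_path_edges_eq_nth)
  qed
  then show ?thesis unfolding is_cycle_def by blast
qed

text \<open>Rotating the vertex list makes \<open>v\<close> its head; the rest \<open>ws\<close> is
  the path that remains when \<open>v\<close> is deleted. This replaces index arithmetic modulo the
  length.\<close>

lemma is_cycle_startE: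
  assumes "is_cycle C" "v \<in> verts C"
  obtains ws where "v \<notin> set ws" "distinct ws" "length ws \<ge> 2" "verts C = insert v (set ws)"
    "edges C = {{last ws, v}, {v, hd ws}} \<union> path_edges ws"
proof -
  obtain vs where vs: "distinct vs" "length vs \<ge> 3" "C = Graph (set vs) (closed_path_edges vs)"
    using assms(1) is_cycle_iff by auto
  obtain i where i: "i < length vs" "vs ! i = v" using assms(2) vs(3) by (auto simp: in_set_conv_nth)
  define us where "us = rotate i vs"
  have "vs \<noteq> []" using vs by auto
  then have "hd us = v" using i by (simp add: us_def hd_rotate_conv_nth)
  moreover have us: "distinct us" "length us \<ge> 3" "set us = set vs" using vs by (simp_all add: us_def)
  moreover have "us \<noteq> []" using us(2) by auto
  ultimately obtain ws where ws: "us = v # ws" by (metis list.collapse)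
  have "closed_path_edges us = closed_path_edges vs" using vs by (simp add: us_def closed_path_edges_rotate)
  moreover have "ws \<noteq> []" using us ws by auto
  ultimately have "edges C = {{last ws, v}, {v, hd ws}} \<union> path_edges ws"
    using ws vs by (auto simp: closed_path_edges_def path_edges_Cons)
  moreover have "verts C = insert v (set ws)" using us(3) ws vs by simp
  ultimately show thesis using that us ws by auto
qed

section \<open>Reachability and simple paths\<close>

lemma adj_sym: "(u, v) \<in> adj G \<Longrightarrow> (v, u) \<in> adj G"
  by (simp add: adj_def insert_commute)

lemma adj_rtrancl_sym: "(u, v) \<in> (adj G)\<^sup>* \<Longrightarrow> (v, u) \<in> (adj G)\<^sup>*"
  using adj_sym by (metis sym_def sym_rtrancl)

lemma adj_mono: "edges H \<subseteq> edges G \<Longrightarrow> adj H \<subseteq> adj G"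
  by (auto simp: adj_def)

lemma adj_rtrancl_mono: "edges H \<subseteq> edges G \<Longrightarrow> (u, v) \<in> (adj H)\<^sup>* \<Longrightarrow> (u, v) \<in> (adj G)\<^sup>*"
  using rtrancl_mono[OF adj_mono] by blast

lemma edge_rtrancl: "{u, v} \<in> edges G \<Longrightarrow> (u, v) \<in> (adj G)\<^sup>*"
  by (auto simp: adj_def)

text \<open>Reachability depends on the edges alone, so fewer vertices only mean fewer pairs to
  check. This is how isolated vertices are discarded.\<close>

lemma graph_connected_anti_verts:
  "graph_connected G \<Longrightarrow> edges G = edges H \<Longrightarrow> verts H \<subseteq> verts G \<Longrightarrow> graph_connected H"
  unfolding graph_connected_def adj_def by auto

text \<open>Induction on the walk: the new end vertex is appended, unless the path already visits
  it, in which case the path is cut off there.\<close>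

lemma rtrancl_adj_path:
  assumes "(u, v) \<in> (adj G)\<^sup>*"
  shows "\<exists>p. p \<noteq> [] \<and> hd p = u \<and> last p = v \<and> distinct p \<and> path_edges p \<subseteq> edges G"
  using assms
proof (induction rule: rtrancl_induct)
  case base
  show ?case by (rule exI[of _ "[u]"]) simp
next
  case (step y z)
  then obtain p where p: "p \<noteq> []" "hd p = u" "last p = y" "distinct p" "path_edges p \<subseteq> edges G" by auto
  show ?case
  proof (cases "z \<in> set p")
    case True
    then obtain xs ys where xs: "p = (xs @ [z]) @ ys" by (metis append.assoc append_Cons append_Nil split_list)
    then have "path_edges (xs @ [z]) \<subseteq> edges G" using p path_edges_append_subset by blast
    moreover have "hd (xs @ [z]) = u" using p(2) xs by (cases xs) auto
    ultimately show ?thesis using p(4) xs by (intro exI[of _ "xs @ [z]"]) auto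
  next
    case False
    then show ?thesis using p step(2)
      by (intro exI[of _ "p @ [z]"]) (auto simp: path_edges_snoc adj_def)
  qed
qed

lemma path_rtrancl_adj:
  "path_edges p \<subseteq> edges G \<Longrightarrow> x \<in> set p \<Longrightarrow> (hd p, x) \<in> (adj G)\<^sup>*"
proof (induction p rule: path_edges.induct)
  case (1 x' y zs)
  have "(x', y) \<in> adj G" using 1(2) by (auto simp: adj_def)
  then show ?case using 1 by (auto intro: converse_rtrancl_into_rtrancl)
qed auto

lemma path_connected:
  assumes "path_edges p \<subseteq> edges G" "x \<in> set p" "y \<in> set p"
  shows "(x, y) \<in> (adj G)\<^sup>*"
  using path_rtrancl_adj[OF assms(1,2)] path_rtrancl_adj[OF assms(1,3)] adj_rtrancl_sym
  by (meson rtrancl_trans)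

section \<open>Graphs, cycles and bridges\<close>

lemma is_graph_edgeE:
  assumes "is_graph G" "e \<in> edges G" "u \<in> e"
  obtains v where "e = {u, v}" "u \<noteq> v" "u \<in> verts G" "v \<in> verts G"
proof -
  have "card e = 2" "e \<subseteq> verts G" using assms by (auto simp: is_graph_def)
  then show thesis using that assms(3) by (auto simp: card_2_iff)
qed

lemma is_graph_edge_verts:
  "is_graph G \<Longrightarrow> {u, v} \<in> edges G \<Longrightarrow> u \<noteq> v \<and> u \<in> verts G \<and> v \<in> verts G"
  by (auto simp: is_graph_def)

lemma is_graph_nonempty_edge: "is_graph G \<Longrightarrow> e \<in> edges G \<Longrightarrow> \<exists>u. u \<in> e"
  unfolding is_graph_def by (metis card.empty ex_in_conv zero_neq_numeral)

lemma finite_edges: "is_graph G \<Longrightarrow> finite (edges G)"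
  unfolding is_graph_def by (meson PowI finite_Pow_iff finite_subset subsetI)

lemma is_graph_delete_edge: "is_graph G \<Longrightarrow> is_graph (delete_edge G e)"
  by (auto simp: is_graph_def delete_edge_def)

lemma subgraph_trans: "subgraph H K \<Longrightarrow> subgraph K G \<Longrightarrow> subgraph H G"
  by (auto simp: subgraph_def)

lemma cycles_mono: "subgraph H G \<Longrightarrow> cycles H \<subseteq> cycles G"
  by (auto simp: cycles_def intro: subgraph_trans)

lemma finite_subgraphs:
  assumes "is_graph G"
  shows "finite {H. subgraph H G}"
proof (rule finite_subset)
  show "{H. subgraph H G} \<subseteq> (\<lambda>(V, E). Graph V E) ` (Pow (verts G) \<times> Pow (edges G))"
  proof
    fix H assume "H \<in> {H. subgraph H G}"
    then have "H = (\<lambda>(V, E). Graph V E) (verts H, edges H)"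
      "(verts H, edges H) \<in> Pow (verts G) \<times> Pow (edges G)"
      by (auto simp: subgraph_def)
    then show "H \<in> (\<lambda>(V, E). Graph V E) ` (Pow (verts G) \<times> Pow (edges G))" by (rule image_eqI)
  qed
  show "finite ((\<lambda>(V, E). Graph V E) ` (Pow (verts G) \<times> Pow (edges G)))"
    using assms finite_edges by (auto simp: is_graph_def)
qed

lemma finite_cycles: "is_graph G \<Longrightarrow> finite (cycles G)"
  by (rule finite_subset[OF _ finite_subgraphs]) (auto simp: cycles_def)

lemma closed_path_in_cycles:
  assumes "is_graph G" "distinct p" "length p \<ge> 3" "closed_path_edges p \<subseteq> edges G"
  shows "Graph (set p) (closed_path_edges p) \<in> cycles G"
proof -
  have ne: "p \<noteq> []" using assms(3) by auto
  have sub: "e \<subseteq> set p" if "e \<in> closed_path_edges p" for e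
    using that ne path_edges_subset by (fastforce simp: closed_path_edges_def)
  \<comment> \<open>Only the edges are assumed to lie in \<open>G\<close>; each vertex of the closed
    path starts one of them and so lies in \<open>G\<close> as well.\<close>
  have "x \<in> verts G" if "x \<in> set p" for x
  proof -
    obtain i where i: "i < length p" "p ! i = x" using \<open>x \<in> set p\<close> by (auto simp: in_set_conv_nth)
    then have "{x, p ! (Suc i mod length p)} \<in> closed_path_edges p"
      unfolding closed_path_edges_eq_nth[OF ne] by auto
    then have "{x, p ! (Suc i mod length p)} \<in> edges G" using assms(4) by blast
    then show ?thesis using is_graph_edge_verts[OF assms(1)] by blast
  qed
  then have "set p \<subseteq> verts G" by blast
  moreover have "is_graph (Graph (set p) (closed_path_edges p))"
    unfolding is_graph_def
  proof (intro conjI ballI)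
    fix e assume "e \<in> edges (Graph (set p) (closed_path_edges p))"
    then have "e \<in> closed_path_edges p" by simp
    then show "e \<subseteq> verts (Graph (set p) (closed_path_edges p))" "card e = 2"
      using sub assms(1,4) by (auto simp: is_graph_def)
  qed simp
  ultimately have "subgraph (Graph (set p) (closed_path_edges p)) G"
    using assms(1,4) by (simp add: subgraph_def)
  moreover have "is_cycle (Graph (set p) (closed_path_edges p))"
    unfolding is_cycle_iff using assms by blast
  ultimately show ?thesis by (simp add: cycles_def)
qed

text \<open>A simple path between the ends that avoids the edge closes up with it to a
  cycle.\<close>

lemma nonseparating_edge_in_cycle:
  assumes G: "is_graph G" and e: "{u, v} \<in> edges G"
    and uv: "(u, v) \<in> (adj (delete_edge G {u, v}))\<^sup>*"
  shows "\<exists>C\<in>cycles G. {u, v} \<in> edges C"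
proof -
  obtain p where p: "p \<noteq> []" "hd p = u" "last p = v" "distinct p" "path_edges p \<subseteq> edges G - {{u, v}}"
    using rtrancl_adj_path[OF uv] by (auto simp: delete_edge_def)
  have "u \<noteq> v" using G e is_graph_edge_verts by metis
  then obtain y ys where y: "p = u # y # ys" using p by (cases p; cases "tl p") auto
  \<comment> \<open>With \<open>ys\<close> empty, the path would consist of the edge
    \<open>{u, v}\<close>, which it avoids. So it has at least three vertices.\<close>
  have "ys \<noteq> []" using p(3,5) y by auto
  then have "length p \<ge> 3" using y by (cases ys) auto
  moreover have cp: "closed_path_edges p = insert {u, v} (path_edges p)"
    using p by (simp add: closed_path_edges_def insert_commute)
  ultimately have "Graph (set p) (closed_path_edges p) \<in> cycles G"
    using closed_path_in_cycles[OF G p(4)] p(5) e by auto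
  then show ?thesis using cp by force
qed

section \<open>Cycles and 2-connectedness\<close>

lemma is_cycle_two_connected:
  assumes "is_cycle C"
  shows "two_connected C"
proof -
  obtain vs where vs: "distinct vs" "length vs \<ge> 3" "C = Graph (set vs) (closed_path_edges vs)"
    using assms is_cycle_iff by auto
  have "graph_connected C"
    unfolding graph_connected_def using vs path_connected[of vs C]
    by (auto simp: closed_path_edges_def)
  moreover have "card (verts C) \<ge> 3" using vs by (simp add: distinct_card)
  moreover have "graph_connected (delete_vertex C v)" if v: "v \<in> verts C" for v
  proof -
    obtain ws where ws: "v \<notin> set ws" "verts C = insert v (set ws)"
      "edges C = {{last ws, v}, {v, hd ws}} \<union> path_edges ws"
      using is_cycle_startE[OF assms v] by metis
    have "path_edges ws \<subseteq> edges (delete_vertex C v)"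
      using ws(1,3) path_edges_subset[of _ ws] by (auto simp: delete_vertex_def)
    moreover have "verts (delete_vertex C v) = set ws" using ws by (auto simp: delete_vertex_def)
    ultimately show ?thesis unfolding graph_connected_def by (simp add: path_connected)
  qed
  ultimately show ?thesis by (simp add: two_connected_def)
qed

text \<open>On the cycle, the edges at \<open>v\<close> are the two joining it to the ends of the
  remaining path; off the cycle there are none.\<close>

lemma cycle_degree:
  assumes "is_cycle C"
  shows "even (degree C v)"
proof (cases "v \<in> verts C")
  case True
  then obtain ws where ws: "v \<notin> set ws" "distinct ws" "length ws \<ge> 2" "verts C = insert v (set ws)"
      "edges C = {{last ws, v}, {v, hd ws}} \<union> path_edges ws"
    using is_cycle_startE[OF assms] by metis
  have "{e \<in> edges C. v \<in> e} = {{last ws, v}, {v, hd ws}}"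
    using ws path_edges_subset by fastforce
  \<comment> \<open>The list \<open>ws\<close> is distinct and has at least two entries, so the two
    edges at \<open>v\<close> do not collapse to one.\<close>
  moreover have "last ws \<noteq> hd ws" using ws by (cases ws; cases "tl ws") auto
  then have "{last ws, v} \<noteq> {v, hd ws}" by (auto simp: doubleton_eq_iff)
  ultimately show ?thesis by (simp add: degree_def)
next
  case False
  obtain vs where vs: "distinct vs" "length vs \<ge> 3" "C = Graph (set vs) (closed_path_edges vs)"
    using assms is_cycle_iff by auto
  then have "{e \<in> edges C. v \<in> e} = {}"
    using False path_edges_subset[of _ vs] by (cases vs) (auto simp: closed_path_edges_def)
  then show ?thesis unfolding degree_def by (simp only: card.empty even_zero)
qed

text \<open>Detour through a third vertex \<open>w\<close>: a walk from \<open>u\<close> to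
  \<open>w\<close> avoiding \<open>v\<close>, followed by one from \<open>w\<close> to
  \<open>v\<close> avoiding \<open>u\<close>, never uses the edge \<open>{u, v}\<close>.\<close>

lemma two_connected_edge_nonseparating:
  assumes G: "is_graph G" "two_connected G" and e: "{u, v} \<in> edges G"
  shows "(u, v) \<in> (adj (delete_edge G {u, v}))\<^sup>*"
proof -
  have uv: "u \<noteq> v" "u \<in> verts G" "v \<in> verts G" using is_graph_edge_verts[OF G(1) e] by auto
  have "card {u, v} < card (verts G)" using uv G(2) by (simp add: two_connected_def)
  then have "\<not> verts G \<subseteq> {u, v}" by (metis card_mono finite.emptyI finite_insert leD)
  then obtain w where w: "w \<in> verts G" "w \<noteq> u" "w \<noteq> v" by auto
  have "(u, w) \<in> (adj (delete_vertex G v))\<^sup>*" "(w, v) \<in> (adj (delete_vertex G u))\<^sup>*"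
    using G(2) w uv by (auto simp: two_connected_def graph_connected_def delete_vertex_def)
  then have "(u, w) \<in> (adj (delete_edge G {u, v}))\<^sup>*" "(w, v) \<in> (adj (delete_edge G {u, v}))\<^sup>*"
    by (auto elim!: adj_rtrancl_mono[rotated] simp: delete_vertex_def delete_edge_def)
  then show ?thesis by simp
qed

text \<open>Deleting \<open>u\<close> leaves a path from \<open>a\<close> to \<open>b\<close>, and
  putting \<open>u\<close> back closes it to a cycle through both edges.\<close>

lemma two_connected_adjacent_edges_in_cycle:
  assumes G: "is_graph G" "two_connected G" and e: "{u, a} \<in> edges G" "{u, b} \<in> edges G" "a \<noteq> b"
  shows "\<exists>C\<in>cycles G. {u, a} \<in> edges C \<and> {u, b} \<in> edges C"
proof -
  have uv: "u \<noteq> a" "u \<noteq> b" "u \<in> verts G" "a \<in> verts G" "b \<in> verts G"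
    using is_graph_edge_verts[OF G(1)] e by blast+
  have "(a, b) \<in> (adj (delete_vertex G u))\<^sup>*"
    using G(2) uv by (auto simp: two_connected_def graph_connected_def delete_vertex_def)
  then obtain p where p: "p \<noteq> []" "hd p = a" "last p = b" "distinct p"
      "path_edges p \<subseteq> edges (delete_vertex G u)"
    using rtrancl_adj_path by metis
  then obtain y ys where y: "p = a # y # ys" using e(3) by (cases p; cases "tl p") auto
  \<comment> \<open>The path is controlled only through its edges. As \<open>u\<close> is not its
    first vertex \<open>a\<close>, it would be entered by an edge, but no edge at \<open>u\<close>
    survives the deletion.\<close>
  have "u \<notin> set p"
  proof
    assume "u \<in> set p"
    then obtain i where i: "i < length p" "p ! i = u" by (auto simp: in_set_conv_nth)
    then have "i \<noteq> 0" using uv(1) y by (cases i) auto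
    then have "{p ! (i - 1), u} \<in> path_edges p"
      unfolding path_edges_eq_nth using i by (auto intro!: exI[of _ "i - 1"])
    then show False using p(5) by (auto simp: delete_vertex_def)
  qed
  moreover have cp: "closed_path_edges (u # p) = insert {u, b} (insert {u, a} (path_edges p))"
    using p by (auto simp: closed_path_edges_def path_edges_Cons insert_commute)
  ultimately have "Graph (set (u # p)) (closed_path_edges (u # p)) \<in> cycles G"
    using closed_path_in_cycles[OF G(1), of "u # p"] p e y by (auto simp: delete_vertex_def)
  then show ?thesis using cp by force
qed

lemma two_connected_has_edge:
  assumes G: "is_graph G" "two_connected G"
  shows "\<exists>u v. {u, v} \<in> edges G"
proof -
  have c: "card (verts G) \<ge> 3" using G by (simp add: two_connected_def)
  have "\<not> verts G \<subseteq> {u}" for u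
  proof
    assume "verts G \<subseteq> {u}"
    then have "card (verts G) \<le> card {u}" by (intro card_mono) auto
    then show False using c by simp
  qed
  moreover obtain u where u: "u \<in> verts G" using c by fastforce
  ultimately obtain v where v: "v \<in> verts G" "v \<noteq> u" by blast
  then have "(u, v) \<in> (adj G)\<^sup>*" using G u by (auto simp: two_connected_def graph_connected_def)
  then obtain w where "(u, w) \<in> adj G" using v by (metis converse_rtranclE)
  then show ?thesis by (auto simp: adj_def)
qed

lemma two_connected_has_cycle:
  assumes "is_graph G" "two_connected G"
  shows "\<exists>C. C \<in> cycles G"
  using two_connected_has_edge[OF assms] two_connected_edge_nonseparating[OF assms]
    nonseparating_edge_in_cycle[OF assms(1)] by metis

section \<open>Bridges and edges on cycles\<close>

lemma cycle_edge_nonseparating: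
  assumes "C \<in> cycles G" "{u, v} \<in> edges C"
  shows "(u, v) \<in> (adj (delete_edge G {u, v}))\<^sup>*"
proof -
  have C: "is_graph C" "is_cycle C" "edges C \<subseteq> edges G" using assms by (auto simp: cycles_def subgraph_def)
  have "(u, v) \<in> (adj (delete_edge C {u, v}))\<^sup>*"
    using two_connected_edge_nonseparating[OF C(1) is_cycle_two_connected[OF C(2)] assms(2)] .
  then show ?thesis by (rule adj_rtrancl_mono[rotated]) (use C in \<open>auto simp: delete_edge_def\<close>)
qed

text \<open>The components of \<open>H\<close>, the graph without the edge, map onto those of
  \<open>G\<close>. If \<open>H\<close> still connects \<open>u\<close> and \<open>v\<close>, the
  components agree; otherwise two of them are merged, and the count drops.\<close>

lemma bridge_iff_separating:
  assumes G: "is_graph G" and e: "{u, v} \<in> edges G"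
  shows "bridge G {u, v} \<longleftrightarrow> (u, v) \<notin> (adj (delete_edge G {u, v}))\<^sup>*"
proof -
  define H where "H = delete_edge G {u, v}"
  have VH: "verts H = verts G" by (simp add: H_def delete_edge_def)
  \<comment> \<open>Both sets of components become quotients of the same vertex set, so that the two
    relations can be compared by inclusion.\<close>
  define R where "R K = {(x, y). x \<in> verts G \<and> y \<in> verts G \<and> (x, y) \<in> (adj K)\<^sup>*}" for K :: "'a graph"
  have cG: "graph_components G = verts G // R G" and cH: "graph_components H = verts G // R H"
    by (auto simp: graph_components_def R_def VH)
  have uv: "u \<in> verts G" "v \<in> verts G" using is_graph_edge_verts[OF G e] by auto
  have fin: "finite (verts G)" using G by (simp add: is_graph_def)
  have eR: "equiv (verts G) (R K)" for K
  proof (rule equivI)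
    show "sym (R K)" unfolding sym_def R_def by (blast intro: adj_rtrancl_sym)
    show "trans (R K)" unfolding trans_def R_def by (blast intro: rtrancl_trans)
  qed (auto simp: R_def refl_on_def)
  have sub: "R H \<subseteq> R G"
    by (auto simp: R_def H_def delete_edge_def elim!: adj_rtrancl_mono[rotated])
  show ?thesis
  proof (cases "(u, v) \<in> (adj H)\<^sup>*")
    case True
    \<comment> \<open>Each use of the deleted edge is replaced by the walk in \<open>H\<close>
      between its ends.\<close>
    have "adj G \<subseteq> (adj H)\<^sup>*"
    proof
      fix z assume "z \<in> adj G"
      moreover obtain x y where z: "z = (x, y)" by force
      ultimately have "{x, y} \<in> edges H \<or> {x, y} = {u, v}" by (auto simp: adj_def H_def delete_edge_def)
      then show "z \<in> (adj H)\<^sup>*"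
        using True adj_rtrancl_sym[OF True] edge_rtrancl z by (auto simp: doubleton_eq_iff)
    qed
    then have "(adj G)\<^sup>* \<subseteq> (adj H)\<^sup>*" by (metis rtrancl_mono rtrancl_idemp)
    then have "R G \<subseteq> R H" by (auto simp: R_def)
    then have "graph_components G = graph_components H" using sub cG cH by auto
    then show ?thesis using True by (simp add: bridge_def H_def)
  next
    case False
    \<comment> \<open>Since \<open>R H\<close> refines \<open>R G\<close>, the
      \<open>R G\<close>-image of an \<open>R H\<close>-class is the full \<open>R G\<close>-class
      around it. This gives the surjection of components.\<close>
    have im: "R G `` (R H `` {x}) = R G `` {x}" if "x \<in> verts G" for x
    proof
      have "trans (R G)" using eR by (simp add: equiv_def)
      then show "R G `` (R H `` {x}) \<subseteq> R G `` {x}"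
        using sub unfolding trans_def by blast
      have "x \<in> R H `` {x}" using that by (simp add: R_def)
      then show "R G `` {x} \<subseteq> R G `` (R H `` {x})" by blast
    qed
    have "graph_components G = (\<lambda>X. R G `` X) ` graph_components H"
      unfolding cG cH quotient_def using im by (auto simp: image_UN)
    \<comment> \<open>The classes of \<open>u\<close> and \<open>v\<close> differ in
      \<open>H\<close> but have the same image; on a finite set, a map that is not injective has a
      strictly smaller image.\<close>
    moreover have "\<not> inj_on (\<lambda>X. R G `` X) (graph_components H)"
    proof
      assume inj: "inj_on (\<lambda>X. R G `` X) (graph_components H)"
      have "(u, v) \<in> R G" using uv edge_rtrancl[OF e] by (simp add: R_def)
      then have "R G `` {u} = R G `` {v}" using eR by (metis equiv_class_eq)
      then have "R G `` (R H `` {u}) = R G `` (R H `` {v})" using im uv by simp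
      then have "R H `` {u} = R H `` {v}"
        using inj uv unfolding inj_on_def cH by (meson quotientI)
      then have "(u, v) \<in> R H" using eR[of H] uv by (metis eq_equiv_class)
      then show False using False by (simp add: R_def)
    qed
    moreover have "finite (graph_components H)"
      unfolding cH using fin by (rule finite_quotient) (auto simp: R_def)
    ultimately have "card (graph_components G) < card (graph_components H)"
      by (metis card_image_le inj_on_iff_eq_card le_neq_implies_less)
    then show ?thesis using False e by (simp add: bridge_def H_def)
  qed
qed

lemma nonbridge_iff_in_cycle:
  assumes "is_graph G" "e \<in> edges G"
  shows "\<not> bridge G e \<longleftrightarrow> (\<exists>C\<in>cycles G. e \<in> edges C)"
proof -
  obtain u v where uv: "e = {u, v}" using assms by (metis is_graph_nonempty_edge is_graph_edgeE)
  show ?thesis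
    using assms bridge_iff_separating nonseparating_edge_in_cycle cycle_edge_nonseparating
    unfolding uv by metis
qed

section \<open>Degrees and parity\<close>

lemma degree_zero_iff: "is_graph G \<Longrightarrow> degree G v = 0 \<longleftrightarrow> (\<forall>e\<in>edges G. v \<notin> e)"
  unfolding degree_def using finite_edges[of G] by auto

lemma delete_isolated_subgraph: "is_graph G \<Longrightarrow> subgraph (delete_isolated G) G"
  using degree_zero_iff[of G] by (auto simp: subgraph_def is_graph_def delete_isolated_def)

lemma edges_delete_isolated [simp]: "edges (delete_isolated G) = edges G"
  by (simp add: delete_isolated_def)

text \<open>Handshake argument on a vertex set that no edge leaves: after exchanging the sums, each
  edge contributes 2 or 0.\<close>

lemma even_degree_sum:
  assumes G: "is_graph G" and S: "S \<subseteq> verts G" "\<And>e. e \<in> edges G \<Longrightarrow> e \<subseteq> S \<or> e \<inter> S = {}"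
  shows "even (\<Sum>v\<in>S. degree G v)"
proof -
  have fS: "finite S" using G S(1) by (auto simp: is_graph_def intro: finite_subset)
  have fE: "finite (edges G)" using finite_edges[OF G] .
  have "(\<Sum>v\<in>S. degree G v) = (\<Sum>v\<in>S. \<Sum>e\<in>edges G. if v \<in> e then 1 else 0)"
    using fE by (simp add: degree_def sum.If_cases Int_def)
  also have "\<dots> = (\<Sum>e\<in>edges G. \<Sum>v\<in>S. if v \<in> e then 1 else 0)" by (rule sum.swap)
  also have "\<dots> = (\<Sum>e\<in>edges G. card (e \<inter> S))"
    using fS by (simp add: sum.If_cases Int_def conj_commute)
  also have "even \<dots>"
  proof (rule dvd_sum)
    fix e assume e: "e \<in> edges G"
    then have "e \<inter> S = e \<or> e \<inter> S = {}" using S(2) by auto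
    moreover have "card e = 2" using G e by (auto simp: is_graph_def)
    ultimately show "even (card (e \<inter> S))" by (metis card.empty dvd_0_right dvd_refl)
  qed
  finally show ?thesis .
qed

text \<open>Deleting a bridge would leave a component with exactly one vertex of odd degree.\<close>

lemma even_degrees_no_bridge:
  assumes G: "is_graph G" and even: "\<And>v. v \<in> verts G \<Longrightarrow> even (degree G v)"
  shows "\<not> bridge G e"
proof
  assume b: "bridge G e"
  then have e: "e \<in> edges G" by (simp add: bridge_def)
  then obtain u v where uv: "e = {u, v}" using G by (metis is_graph_nonempty_edge is_graph_edgeE)
  have uv': "u \<noteq> v" "u \<in> verts G" "v \<in> verts G" using is_graph_edge_verts[OF G] e uv by auto
  define H where "H = delete_edge G e"
  have H: "is_graph H" "verts H = verts G" "edges H = edges G - {e}"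
    using is_graph_delete_edge[OF G] by (auto simp: H_def delete_edge_def)
  define S where "S = {x \<in> verts G. (u, x) \<in> (adj H)\<^sup>*}"
  have vS: "v \<notin> S" using b bridge_iff_separating[OF G] e uv by (auto simp: S_def H_def)
  have uS: "u \<in> S" using uv' by (simp add: S_def)
  have fS: "finite S" using G by (simp add: S_def is_graph_def)
  have "even (\<Sum>x\<in>S. degree H x)"
  proof (rule even_degree_sum[OF H(1)])
    show "S \<subseteq> verts H" using H by (auto simp: S_def)
    fix d assume d: "d \<in> edges H"
    have "d \<subseteq> S" if x: "x \<in> d" "x \<in> S" for x
    proof -
      obtain y where y: "d = {x, y}" "y \<in> verts H" using is_graph_edgeE[OF H(1) d x(1)] by metis
      then have "(x, y) \<in> adj H" using d by (simp add: adj_def)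
      moreover have "(u, x) \<in> (adj H)\<^sup>*" using x by (simp add: S_def)
      ultimately have "(u, y) \<in> (adj H)\<^sup>*" by simp
      then show ?thesis using y x H by (simp add: S_def)
    qed
    then show "d \<subseteq> S \<or> d \<inter> S = {}" by blast
  qed
  also have "(\<Sum>x\<in>S. degree H x) = degree H u + (\<Sum>x\<in>S - {u}. degree H x)"
    using fS uS by (rule sum.remove)
  \<comment> \<open>The other end \<open>v\<close> of \<open>e\<close> lies outside
    \<open>S\<close>, so within \<open>S\<close> only the degree of \<open>u\<close> changes when
    \<open>e\<close> is deleted.\<close>
  also have "(\<Sum>x\<in>S - {u}. degree H x) = (\<Sum>x\<in>S - {u}. degree G x)"
  proof (rule sum.cong)
    fix x assume "x \<in> S - {u}"
    then have "x \<notin> e" using vS uv by auto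
    then have "{d \<in> edges H. x \<in> d} = {d \<in> edges G. x \<in> d}" using H by auto
    then show "degree H x = degree G x" by (simp add: degree_def)
  qed simp
  finally have "even (degree H u + (\<Sum>x\<in>S - {u}. degree G x))" .
  moreover have "even (\<Sum>x\<in>S - {u}. degree G x)"
    using even by (intro dvd_sum) (auto simp: S_def)
  ultimately have "even (degree H u)" by simp
  moreover have "{d \<in> edges G. u \<in> d} = insert e {d \<in> edges H. u \<in> d}" using H e uv by auto
  then have "degree G u = Suc (degree H u)"
    using finite_edges[OF H(1)] H(3) by (simp add: degree_def)
  ultimately show False using even[OF uv'(2)] by simp
qed

section \<open>Cactus graphs\<close>

lemma cactus_subgraph: "cactus G \<Longrightarrow> subgraph H G \<Longrightarrow> cactus H"
  using cycles_mono[of H G] unfolding cactus_def subgraph_def by blast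

lemma cactus_cycles_eqI:
  assumes "cactus G" "C \<in> cycles G" "D \<in> cycles G" "a \<noteq> b" "{a, b} \<subseteq> verts C \<inter> verts D"
  shows "C = D"
proof (rule ccontr)
  assume "C \<noteq> D"
  then have "card (verts C \<inter> verts D) \<le> 1" using assms by (auto simp: cactus_def)
  moreover have "finite (verts C \<inter> verts D)"
    using assms(2) by (auto simp: cycles_def subgraph_def is_graph_def)
  then have "card {a, b} \<le> card (verts C \<inter> verts D)" using assms(5) by (rule card_mono)
  ultimately show False using assms(4) by simp
qed

lemma cycle_is_graph: "C \<in> cycles G \<Longrightarrow> is_graph C"
  by (simp add: cycles_def subgraph_def)

text \<open>The two ends of the edge are already two common vertices.\<close>

lemma cactus_common_edge_eq:
  assumes "cactus G" "C \<in> cycles G" "D \<in> cycles G" "e \<in> edges C" "e \<in> edges D"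
  shows "C = D"
proof -
  have C: "is_graph C" "is_graph D" using assms cycle_is_graph by auto
  then have "card e = 2" using assms(4) by (auto simp: is_graph_def)
  then obtain a b where ab: "e = {a, b}" "a \<noteq> b" by (auto simp: card_2_iff)
  have "e \<subseteq> verts C \<inter> verts D" using C assms(4,5) by (auto simp: is_graph_def)
  then show ?thesis using cactus_cycles_eqI[OF assms(1-3) ab(2)] ab(1) by simp
qed

section \<open>Unions of cycles in a cactus\<close>

lemma graph_Union_sel [simp]:
  "verts (graph_Union A) = (\<Union>B\<in>A. verts B)" "edges (graph_Union A) = (\<Union>B\<in>A. edges B)"
  by (simp_all add: graph_Union_def)

lemma graph_Union_cycles_subgraph:
  assumes "is_graph G" "A \<subseteq> cycles G"
  shows "subgraph (graph_Union A) G"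
proof -
  have B: "verts B \<subseteq> verts G" "edges B \<subseteq> edges G" "is_graph B" if "B \<in> A" for B
    using that assms by (auto simp: cycles_def subgraph_def)
  then have "(\<Union>B\<in>A. verts B) \<subseteq> verts G" "(\<Union>B\<in>A. edges B) \<subseteq> edges G" by blast+
  moreover from this have "finite (verts (graph_Union A))"
    using assms(1) by (auto simp: is_graph_def intro: finite_subset)
  then have "is_graph (graph_Union A)"
    using B(3) by (auto simp: is_graph_def)
  ultimately show ?thesis using assms(1) by (simp add: subgraph_def)
qed

text \<open>Cycles of a cactus are edge-disjoint, so a degree in the union is the sum of the even
  degrees in the single cycles.\<close>

lemma cactus_Union_cycles_degree:
  assumes G: "cactus G" and A: "A \<subseteq> cycles G"
  shows "even (degree (graph_Union A) v)"
proof -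
  have fA: "finite A" using finite_cycles G A by (auto simp: cactus_def intro: finite_subset)
  have "{e \<in> edges (graph_Union A). v \<in> e} = (\<Union>C\<in>A. {e \<in> edges C. v \<in> e})" by auto
  moreover have "card (\<Union>C\<in>A. {e \<in> edges C. v \<in> e}) = (\<Sum>C\<in>A. card {e \<in> edges C. v \<in> e})"
  proof (rule card_UN_disjoint[OF fA])
    show "\<forall>C\<in>A. finite {e \<in> edges C. v \<in> e}"
      using A cycle_is_graph finite_edges by fastforce
    show "\<forall>C\<in>A. \<forall>D\<in>A. C \<noteq> D \<longrightarrow> {e \<in> edges C. v \<in> e} \<inter> {e \<in> edges D. v \<in> e} = {}"
      using cactus_common_edge_eq[OF G] A by blast
  qed
  ultimately have "degree (graph_Union A) v = (\<Sum>C\<in>A. degree C v)" by (simp add: degree_def)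
  also have "even \<dots>" using A by (intro dvd_sum cycle_degree) (auto simp: cycles_def)
  finally show ?thesis .
qed

text \<open>Only edges are compared: an isolated vertex of \<open>G\<close> lies on no cycle and is
  missing from the union.\<close>

lemma no_bridge_edges_eq_Union_cycles:
  assumes "is_graph G" "\<And>e. \<not> bridge G e"
  shows "edges G = edges (graph_Union (cycles G))"
proof
  show "edges G \<subseteq> edges (graph_Union (cycles G))"
    using nonbridge_iff_in_cycle assms by fastforce
  show "edges (graph_Union (cycles G)) \<subseteq> edges G" by (auto simp: cycles_def subgraph_def)
qed

text \<open>Parity excludes bridges. Conversely, without bridges the edges are a disjoint union of
  cycles, each contributing an even amount to every degree.\<close>

lemma cactus_even_degrees_iff_no_bridge:
  assumes "cactus G"
  shows "(\<forall>v\<in>verts G. even (degree G v)) \<longleftrightarrow> (\<forall>e. \<not> bridge G e)"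
proof
  have G: "is_graph G" using assms by (simp add: cactus_def)
  show "\<forall>e. \<not> bridge G e" if "\<forall>v\<in>verts G. even (degree G v)"
    using even_degrees_no_bridge[OF G] that by blast
  show "\<forall>v\<in>verts G. even (degree G v)" if "\<forall>e. \<not> bridge G e"
  proof
    fix v
    have "degree G v = degree (graph_Union (cycles G)) v"
      using no_bridge_edges_eq_Union_cycles[OF G] that by (simp add: degree_def)
    then show "even (degree G v)" using cactus_Union_cycles_degree[OF assms] by simp
  qed
qed

lemma eulerian_no_bridge: "is_graph G \<Longrightarrow> eulerian G \<Longrightarrow> \<not> bridge G e"
  unfolding eulerian_def using even_degrees_no_bridge by blast

text \<open>An edge of \<open>B\<close> at a vertex of \<open>C\<close> lies on a common cycle with an adjacent edge of \<open>C\<close>; this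
  cycle must be \<open>C\<close>, so no edge of \<open>B\<close> leaves \<open>C\<close>.\<close>

lemma cactus_two_connected_eq_cycle:
  assumes B: "cactus B" "two_connected B" and C: "C \<in> cycles B"
  shows "B = C"
proof -
  have gB: "is_graph B" using B by (simp add: cactus_def)
  have gC: "is_graph C" "is_cycle C" "verts C \<subseteq> verts B" "edges C \<subseteq> edges B"
    using C by (auto simp: cycles_def subgraph_def)
  have stay: "{u, w} \<in> edges C" if u: "u \<in> verts C" and w: "{u, w} \<in> edges B" for u w
  proof -
    obtain a where a: "{u, a} \<in> edges C" using is_cycle_startE[OF gC(2) u] by (metis UnI1 insertCI)
    have ua: "u \<noteq> a" "a \<in> verts C" using is_graph_edge_verts[OF gC(1) a] by auto
    show ?thesis
    proof (cases "a = w")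
      case False
      have "{u, a} \<in> edges B" using a gC(4) by blast
      from two_connected_adjacent_edges_in_cycle[OF gB B(2) this w False]
      obtain D where D: "D \<in> cycles B" "{u, a} \<in> edges D" "{u, w} \<in> edges D" by auto
      then show ?thesis using cactus_common_edge_eq[OF B(1) C D(1) a] by simp
    qed (use a in simp)
  qed
  obtain u where u: "u \<in> verts C"
    using is_cycle_two_connected[OF gC(2)] by (fastforce simp: two_connected_def)
  \<comment> \<open>A walk in \<open>B\<close> that starts on \<open>C\<close> stays on
    \<open>C\<close>, and \<open>B\<close> is connected, so \<open>C\<close> spans
    \<open>B\<close>.\<close>
  have "x \<in> verts C" if "x \<in> verts B" for x
  proof -
    have "(u, x) \<in> (adj B)\<^sup>*"
      using that u gC(3) B(2) by (auto simp: two_connected_def graph_connected_def)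
    then show ?thesis
    proof (induction rule: rtrancl_induct)
      case (step y z)
      then show ?case using stay[of y z] is_graph_edge_verts[OF gC(1), of y z] by (auto simp: adj_def)
    qed (rule u)
  qed
  then have V: "verts B = verts C" using gC(3) by blast
  have "e \<in> edges C" if e: "e \<in> edges B" for e
  proof -
    obtain x where "x \<in> e" using is_graph_nonempty_edge[OF gB e] by auto
    then obtain y where "e = {x, y}" "x \<in> verts B" using is_graph_edgeE[OF gB e] by metis
    then show ?thesis using stay[of x y] e V by simp
  qed
  then have "edges B = edges C" using gC(4) by blast
  then show ?thesis using V by (simp add: graph.expand)
qed

text \<open>Without bridges, only maximal 2-connected subgraphs remain. A 2-connected subgraph
  contains a cycle and therefore equals it; applied to a 2-connected graph containing
  \<open>C\<close>, the same fact gives the maximality of \<open>C\<close>.\<close>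

lemma blocks_cactus:
  assumes G: "cactus G" and nb: "\<And>e. \<not> bridge G e"
  shows "blocks G = cycles G"
proof
  show "blocks G \<subseteq> cycles G"
  proof
    fix B assume "B \<in> blocks G"
    then have B: "subgraph B G" "two_connected B" using nb by (auto simp: blocks_def)
    then obtain C where C: "C \<in> cycles B" using two_connected_has_cycle[of B] by (auto simp: subgraph_def)
    then have "B = C" using cactus_two_connected_eq_cycle cactus_subgraph[OF G] B by blast
    then show "B \<in> cycles G" using C cycles_mono[OF B(1)] by auto
  qed
  show "cycles G \<subseteq> blocks G"
  proof
    fix C assume C: "C \<in> cycles G"
    then have "subgraph C G" "two_connected C" by (auto simp: cycles_def is_cycle_two_connected)
    moreover have "K = C" if K: "subgraph K G" "two_connected K" "subgraph C K" for K
    proof -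
      have "C \<in> cycles K" using C K(3) by (auto simp: cycles_def)
      then show ?thesis using cactus_two_connected_eq_cycle cactus_subgraph[OF G] K by blast
    qed
    ultimately show "C \<in> blocks G" by (auto simp: blocks_def)
  qed
qed

section \<open>Eulerian subgraphs of a cactus\<close>

lemma cactus_Union_cycles_eulerian:
  assumes G: "cactus G" and A: "A \<subseteq> cycles G" and con: "graph_connected (graph_Union A)"
  shows "eulerian (graph_Union A)"
proof -
  have "graph_connected (delete_isolated (graph_Union A))"
    using con by (rule graph_connected_anti_verts) (auto simp: delete_isolated_def)
  then show ?thesis unfolding eulerian_def using cactus_Union_cycles_degree[OF G A] by blast
qed

text \<open>No further cycle arises: any edge of a cycle in the union lies on a member of
  \<open>A\<close>, and a common edge forces the two cycles to be equal.\<close>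

lemma cycles_graph_Union:
  assumes G: "cactus G" and A: "A \<subseteq> cycles G"
  shows "cycles (graph_Union A) = A"
proof
  have sub: "subgraph (graph_Union A) G"
    using graph_Union_cycles_subgraph G A by (auto simp: cactus_def)
  show "cycles (graph_Union A) \<subseteq> A"
  proof
    fix C assume C: "C \<in> cycles (graph_Union A)"
    then have "is_graph C" "two_connected C" by (auto simp: cycles_def subgraph_def is_cycle_two_connected)
    then obtain e where e: "e \<in> edges C" using two_connected_has_edge by blast
    then have "e \<in> edges (graph_Union A)" using C by (auto simp: cycles_def subgraph_def)
    then obtain D where "D \<in> A" "e \<in> edges D" by auto
    then show "C \<in> A" using cactus_common_edge_eq[OF G] C e A cycles_mono[OF sub] by (metis subsetD)
  qed
  show "A \<subseteq> cycles (graph_Union A)"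
  proof
    fix C assume C: "C \<in> A"
    then have "is_graph C" "is_cycle C" using A by (auto simp: cycles_def subgraph_def)
    then show "C \<in> cycles (graph_Union A)" using C sub by (auto simp: cycles_def subgraph_def)
  qed
qed

text \<open>No edge of \<open>H\<close> is a bridge, so the union of the cycles has the same edges;
  and no vertex of a cycle is isolated. Connectedness up to isolated vertices thus passes to the
  union.\<close>

lemma eulerian_Union_cycles_connected:
  assumes H: "is_graph H" "eulerian H"
  shows "graph_connected (graph_Union (cycles H))"
proof (rule graph_connected_anti_verts)
  have E: "edges H = edges (graph_Union (cycles H))"
    using no_bridge_edges_eq_Union_cycles H eulerian_no_bridge by blast
  then show "edges (delete_isolated H) = edges (graph_Union (cycles H))" by simp
  show "graph_connected (delete_isolated H)" using H by (simp add: eulerian_def)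
  show "verts (graph_Union (cycles H)) \<subseteq> verts (delete_isolated H)"
  proof
    fix v assume "v \<in> verts (graph_Union (cycles H))"
    then obtain C where C: "C \<in> cycles H" "v \<in> verts C" by auto
    then have "is_cycle C" by (simp add: cycles_def)
    then obtain a where "{v, a} \<in> edges C" using is_cycle_startE C(2) by (metis UnI1 insertCI)
    then have "{v, a} \<in> edges H" using C by (auto simp: cycles_def subgraph_def)
    then show "v \<in> verts (delete_isolated H)"
      using H(1) degree_zero_iff[OF H(1), of v] is_graph_edge_verts[OF H(1)]
      by (auto simp: delete_isolated_def)
  qed
qed

text \<open>The translation uses \<open>cycles\<close> in one direction and
  \<open>graph_Union\<close> in the other; \<open>cycles_graph_Union\<close> recovers
  \<open>A\<close>.\<close>

lemma cactus_eulerian_cycle_sets: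
  assumes "cactus G"
  shows "{cycles H |H. subgraph H G \<and> eulerian H} =
    {A. A \<subseteq> cycles G \<and> graph_connected (graph_Union A)}"
proof -
  have G: "is_graph G" using assms by (simp add: cactus_def)
  show ?thesis
  proof (intro equalityI subsetI)
    fix A assume "A \<in> {cycles H |H. subgraph H G \<and> eulerian H}"
    then obtain H where H: "A = cycles H" "subgraph H G" "eulerian H" by auto
    then have "is_graph H" by (simp add: subgraph_def)
    then show "A \<in> {A. A \<subseteq> cycles G \<and> graph_connected (graph_Union A)}"
      using eulerian_Union_cycles_connected H cycles_mono by blast
  next
    fix A assume "A \<in> {A. A \<subseteq> cycles G \<and> graph_connected (graph_Union A)}"
    then have A: "A \<subseteq> cycles G" "graph_connected (graph_Union A)" by auto
    have "A = cycles (graph_Union A)" using cycles_graph_Union[OF assms A(1)] by simp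
    then show "A \<in> {cycles H |H. subgraph H G \<and> eulerian H}"
      using graph_Union_cycles_subgraph[OF G A(1)] cactus_Union_cycles_eulerian[OF assms A] by blast
  qed
qed

lemma eulerian_edges: "is_graph H \<Longrightarrow> eulerian H \<Longrightarrow> edges H = (\<Union>C\<in>cycles H. edges C)"
  using no_bridge_edges_eq_Union_cycles[of H] eulerian_no_bridge[of H] by simp

text \<open>Evenness and absence of bridges agree in a cactus, but \<open>eulerian\<close> tolerates
  isolated vertices whereas \<open>two_edge_connected\<close> asks for connectedness. Passing to
  \<open>delete_isolated\<close> repairs this and keeps the edge set.\<close>

lemma cactus_eulerian_edge_sets:
  assumes "cactus G"
  shows "{edges H |H. subgraph H G \<and> eulerian H} = {edges H |H. subgraph H G \<and> two_edge_connected H}"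
proof (intro equalityI subsetI)
  fix E assume "E \<in> {edges H |H. subgraph H G \<and> eulerian H}"
  then obtain H where H: "E = edges H" "subgraph H G" "eulerian H" by auto
  have gH: "is_graph H" using H by (simp add: subgraph_def)
  let ?K = "delete_isolated H"
  have K: "subgraph ?K G" using delete_isolated_subgraph[OF gH] H(2) subgraph_trans by blast
  have "\<forall>v\<in>verts ?K. even (degree ?K v)"
    using H(3) by (auto simp: eulerian_def degree_def delete_isolated_def)
  then have "\<forall>e. \<not> bridge ?K e"
    using cactus_even_degrees_iff_no_bridge cactus_subgraph[OF assms K] by blast
  then have "two_edge_connected ?K" using H(3) by (simp add: two_edge_connected_def eulerian_def)
  moreover have "E = edges ?K" using H(1) by simp
  ultimately show "E \<in> {edges H |H. subgraph H G \<and> two_edge_connected H}" using K by blast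
next
  fix E assume "E \<in> {edges H |H. subgraph H G \<and> two_edge_connected H}"
  then obtain H where H: "E = edges H" "subgraph H G" "two_edge_connected H" by auto
  then have "eulerian H"
    unfolding eulerian_def using cactus_even_degrees_iff_no_bridge[OF cactus_subgraph[OF assms H(2)]]
    by (auto simp: two_edge_connected_def delete_isolated_def elim!: graph_connected_anti_verts)
  then show "E \<in> {edges H |H. subgraph H G \<and> eulerian H}" using H by blast
qed

section \<open>Trees\<close>

text \<open>Without cycles there is no 2-connected subgraph, and every edge is a bridge.\<close>

lemma tree_blocks:
  assumes "tree T"
  shows "blocks T = (\<lambda>e. Graph e {e}) ` edges T"
proof -
  have T: "is_graph T" "cycles T = {}" using assms by (auto simp: tree_def)
  have "\<not> (subgraph B T \<and> two_connected B)" for B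
    using two_connected_has_cycle[of B] cycles_mono[of B T] T by (auto simp: subgraph_def)
  moreover have "bridge T e \<longleftrightarrow> e \<in> edges T" for e
    using nonbridge_iff_in_cycle[OF T(1)] T(2) by (auto simp: bridge_def)
  ultimately show ?thesis by (auto simp: blocks_def)
qed

lemma tree_connected_edge_sets:
  assumes "tree T"
  shows "{(\<lambda>B. the_elem (edges B)) ` A |A. A \<subseteq> blocks T \<and> graph_connected (graph_Union A)} =
    {edges H |H. subgraph H T \<and> graph_connected H}" (is "?L = ?R")
proof (intro equalityI subsetI)
  have T: "is_graph T" using assms by (simp add: tree_def)
  fix E assume "E \<in> ?L"
  then obtain A where A: "E = (\<lambda>B. the_elem (edges B)) ` A" "A \<subseteq> (\<lambda>e. Graph e {e}) ` edges T"
      "graph_connected (graph_Union A)"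
    using tree_blocks[OF assms] by auto
  then obtain F where F: "F \<subseteq> edges T" "A = (\<lambda>e. Graph e {e}) ` F" by (meson subset_imageE)
  have "E = F" using A(1) F(2) by (simp add: image_image)
  have "\<Union> F \<subseteq> verts T" using F(1) T by (auto simp: is_graph_def)
  then have "subgraph (graph_Union A) T"
    using T F by (auto simp: subgraph_def is_graph_def intro: finite_subset)
  moreover have "E = edges (graph_Union A)" using \<open>E = F\<close> F(2) by simp
  ultimately show "E \<in> ?R" using A(3) by blast
next
  fix E assume "E \<in> ?R"
  then obtain H where H: "E = edges H" "subgraph H T" "graph_connected H" by auto
  let ?A = "(\<lambda>e. Graph e {e}) ` E"
  \<comment> \<open>The union can lose only isolated vertices of \<open>H\<close>. In particular, a
    one-vertex \<open>H\<close> yields the empty graph, which is connected by convention.\<close>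
  have "\<Union> E \<subseteq> verts H" using H by (auto simp: subgraph_def is_graph_def)
  then have "graph_connected (graph_Union ?A)"
    using graph_connected_anti_verts[OF H(3)] H(1) by simp
  moreover have "E \<subseteq> edges T" using H(1,2) by (simp add: subgraph_def)
  then have "?A \<subseteq> blocks T" unfolding tree_blocks[OF assms] by (rule image_mono)
  moreover have "E = (\<lambda>B. the_elem (edges B)) ` ?A" by (simp add: image_image)
  ultimately show "E \<in> ?L" by blast
qed

section \<open>Polytopes of incidence vectors\<close>

lemma lookup_scaleR_poly_mapping:
  fixes x :: "('i, real) poly_mapping"
  shows "Poly_Mapping.lookup (r *\<^sub>R x) i = r * Poly_Mapping.lookup x i"
proof -
  \<comment> \<open>Scaling is defined through \<open>Abs_poly_mapping\<close>, which can be
    evaluated once the support is known to be finite.\<close>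
  have "finite {i. r *\<^sub>R Poly_Mapping.lookup x i \<noteq> 0}"
    by (rule finite_subset[OF _ finite_lookup[of x]]) auto
  then show ?thesis by (simp add: scaleR_poly_mapping_def Abs_poly_mapping_inverse)
qed

text \<open>Finiteness matters: over an infinite set the defining sum is 0 by default.\<close>

lemma lookup_incidence_vector:
  "finite A \<Longrightarrow> Poly_Mapping.lookup (incidence_vector A) i = of_bool (i \<in> A)"
  by (auto simp: incidence_vector_def lookup_sum lookup_single when_def of_bool_def)

lemma incidence_vector_empty: "incidence_vector {} = 0"
  by (simp add: incidence_vector_def)

lemma incidence_vector_in_lattice_points:
  "finite I \<Longrightarrow> A \<subseteq> I \<Longrightarrow> incidence_vector A \<in> lattice_points I"
  using finite_subset[of A I]
  by (auto simp: lattice_points_def in_keys_iff lookup_incidence_vector)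

lemma lattice_polytope_incidence_vectors:
  assumes "finite I" "\<And>A. A \<in> F \<Longrightarrow> A \<subseteq> I"
  shows "lattice_polytope I (convex hull (incidence_vector ` F))"
proof -
  have "finite F" using assms by (intro finite_subset[of F "Pow I"]) auto
  moreover have "incidence_vector ` F \<subseteq> lattice_points I"
    using assms incidence_vector_in_lattice_points[OF assms(1)] by blast
  ultimately show ?thesis unfolding lattice_polytope_def by blast
qed

section \<open>Linear maps between coordinate spaces\<close>

lemma linear_relabel: "linear (relabel f I)"
  unfolding relabel_def[abs_def]
  by (intro linear_compose_sum ballI linearI poly_mapping_eqI)
    (simp_all add: lookup_single lookup_add lookup_scaleR_poly_mapping when_def)

lemma relabel_incidence_vector:
  assumes "finite I" "inj_on f I" "A \<subseteq> I"
  shows "relabel f I (incidence_vector A) = incidence_vector (f ` A)"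
proof -
  have "finite A" using assms finite_subset by auto
  then have "relabel f I (incidence_vector A) = (\<Sum>i\<in>I. if i \<in> A then Poly_Mapping.single (f i) 1 else 0)"
    unfolding relabel_def by (intro sum.cong) (auto simp: lookup_incidence_vector)
  also have "\<dots> = (\<Sum>i\<in>A. Poly_Mapping.single (f i) 1)"
    using assms by (simp add: sum.If_cases Int_absorb1)
  also have "\<dots> = incidence_vector (f ` A)"
    unfolding incidence_vector_def using inj_on_subset[OF assms(2,3)] by (simp add: sum.reindex)
  finally show ?thesis .
qed

text \<open>Here \<open>g i\<close> plays the role of the edge set of a cycle \<open>i\<close>. The
  condition \<open>{} \<in> F\<close> puts the origin into both polytopes, so their affine hulls are
  linear spans and a linear map suffices.\<close>

lemma unimodular_equivalent_disjoint_unions: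
  fixes g :: "'i \<Rightarrow> 'j set"
  assumes I: "finite I" and J: "finite J"
    and g: "\<And>i. i \<in> I \<Longrightarrow> g i \<noteq> {}" "\<And>i. i \<in> I \<Longrightarrow> g i \<subseteq> J"
    and disj: "\<And>i k e. i \<in> I \<Longrightarrow> k \<in> I \<Longrightarrow> e \<in> g i \<Longrightarrow> e \<in> g k \<Longrightarrow> i = k"
    and F: "{} \<in> F" "\<And>A. A \<in> F \<Longrightarrow> A \<subseteq> I"
  shows "unimodular_equivalent I (convex hull (incidence_vector ` F))
    J (convex hull (incidence_vector ` (\<lambda>A. \<Union>i\<in>A. g i) ` F))"
proof -
  define P where "P = convex hull (incidence_vector ` F)"
  define Q where "Q = convex hull (incidence_vector ` (\<lambda>A. \<Union>i\<in>A. g i) ` F)"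
  define f :: "('i, real) poly_mapping \<Rightarrow> ('j, real) poly_mapping"
    where "f x = (\<Sum>i\<in>I. Poly_Mapping.lookup x i *\<^sub>R incidence_vector (g i))" for x
  \<comment> \<open>This is the coordinate space of \<open>I\<close> among all finitely supported
    functions. As \<open>f\<close> ignores coordinates outside \<open>I\<close>, injectivity can be
    claimed only on \<open>W\<close>, which contains the affine hull of \<open>P\<close>.\<close>
  define W :: "('i, real) poly_mapping set" where "W = {x. \<forall>i. i \<notin> I \<longrightarrow> Poly_Mapping.lookup x i = 0}"
  have fg: "finite (g i)" if "i \<in> I" for i using g(2)[OF that] J by (rule finite_subset)
  have lk: "Poly_Mapping.lookup (f x) e = (\<Sum>i\<in>I. Poly_Mapping.lookup x i * of_bool (e \<in> g i))" for x e
    by (simp add: f_def lookup_sum lookup_scaleR_poly_mapping lookup_incidence_vector fg)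
  \<comment> \<open>By disjointness only the summand of \<open>i\<close> contributes at
    \<open>e\<close>. Injectivity and integrality are both read off from this equation.\<close>
  have lk1: "Poly_Mapping.lookup (f x) e = Poly_Mapping.lookup x i" if "i \<in> I" "e \<in> g i" for x i e
  proof -
    have "(\<Sum>k\<in>I. Poly_Mapping.lookup x k * of_bool (e \<in> g k)) =
        (\<Sum>k\<in>I. if k = i then Poly_Mapping.lookup x i else 0)"
      using disj that by (intro sum.cong) auto
    then show ?thesis using I that by (simp add: lk)
  qed
  have lk0: "Poly_Mapping.lookup (f x) e = 0" if "\<And>i. i \<in> I \<Longrightarrow> e \<notin> g i" for x e
    unfolding lk using that by (intro sum.neutral) auto
  have lin: "linear f"
    by (intro linearI poly_mapping_eqI)
      (simp_all add: lk lookup_add lookup_scaleR_poly_mapping sum.distrib sum_distrib_left algebra_simps)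
  have inc: "f (incidence_vector A) = incidence_vector (\<Union>i\<in>A. g i)" if "A \<subseteq> I" for A
  proof (rule poly_mapping_eqI)
    fix e
    have fin: "finite A" using I that by (rule finite_subset[rotated])
    moreover have "finite (\<Union>i\<in>A. g i)" using fin that fg by auto
    ultimately show "Poly_Mapping.lookup (f (incidence_vector A)) e =
        Poly_Mapping.lookup (incidence_vector (\<Union>i\<in>A. g i)) e"
    proof (cases "\<exists>i\<in>I. e \<in> g i")
      case True
      then obtain i where i: "i \<in> I" "e \<in> g i" by auto
      then have "e \<in> (\<Union>i\<in>A. g i) \<longleftrightarrow> i \<in> A" using disj that by blast
      then show ?thesis using lk1[OF i] fin \<open>finite (\<Union>i\<in>A. g i)\<close> by (simp add: lookup_incidence_vector)
    next
      case False
      then have "e \<notin> (\<Union>i\<in>A. g i)" using that by blast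
      then show ?thesis using lk0[of e] False \<open>finite (\<Union>i\<in>A. g i)\<close> by (simp add: lookup_incidence_vector)
    qed
  qed
  have fPQ: "f ` P = Q"
    unfolding P_def Q_def convex_hull_linear_image[OF lin] image_image
    using inc F(2) by (metis (no_types, lifting) image_cong)
  \<comment> \<open>The origin is the incidence vector of the empty set, and it turns affine hulls
    into spans, which commute with linear maps.\<close>
  have "0 \<in> P" unfolding P_def using F(1) incidence_vector_empty by (metis hull_inc imageI)
  moreover have "f 0 = 0" using lin by (rule linear_0)
  ultimately have "0 \<in> affine hull P" "0 \<in> affine hull Q" using fPQ by (metis hull_inc imageI)+
  then have hP: "affine hull P = span P" and hQ: "affine hull Q = span Q"
    using affine_hull_span_0 by blast+
  have hull: "f ` (affine hull P) = affine hull Q"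
    using linear_span_image[OF lin, of P] by (simp only: hP hQ fPQ)
  have "subspace W"
    by (auto simp: W_def subspace_def lookup_add lookup_scaleR_poly_mapping)
  moreover have "incidence_vector ` F \<subseteq> W"
  proof
    fix x assume "x \<in> incidence_vector ` F"
    then obtain A where A: "x = incidence_vector A" "A \<subseteq> I" using F(2) by auto
    then have "finite A" using I by (metis finite_subset)
    then show "x \<in> W" using A by (auto simp: W_def lookup_incidence_vector)
  qed
  ultimately have "P \<subseteq> W" unfolding P_def by (simp add: hull_minimal subspace_imp_convex)
  then have PW: "affine hull P \<subseteq> W" using \<open>subspace W\<close> by (simp add: hull_minimal subspace_imp_affine)
  have inj: "inj_on f W"
  proof (rule inj_onI, rule poly_mapping_eqI)
    fix x y i assume xy: "x \<in> W" "y \<in> W" "f x = f y"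
    show "Poly_Mapping.lookup x i = Poly_Mapping.lookup y i"
    proof (cases "i \<in> I")
      case True
      then show ?thesis using g(1) lk1[OF True] xy(3) by (metis ex_in_conv)
    next
      case False
      then show ?thesis using xy by (simp add: W_def)
    qed
  qed
  \<comment> \<open>Every coordinate of \<open>x\<close> in \<open>I\<close> reappears in
    \<open>f x\<close> because \<open>g i\<close> is nonempty; conversely, each coordinate of
    \<open>f x\<close> is a coordinate of \<open>x\<close> or 0, and it vanishes outside
    \<open>J\<close>.\<close>
  have lat: "f x \<in> lattice_points J \<longleftrightarrow> x \<in> lattice_points I" if "x \<in> W" for x
  proof
    assume fx: "f x \<in> lattice_points J"
    have "Poly_Mapping.lookup x i \<in> \<int>" if i: "i \<in> I" for i
    proof -
      obtain e where e: "e \<in> g i" using g(1)[OF i] by auto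
      then have "Poly_Mapping.lookup (f x) e \<in> \<int>" using fx g(2)[OF i] by (auto simp: lattice_points_def)
      then show ?thesis using lk1[OF i e] by simp
    qed
    then show "x \<in> lattice_points I" using that by (auto simp: lattice_points_def W_def in_keys_iff)
  next
    assume x: "x \<in> lattice_points I"
    have "Poly_Mapping.lookup (f x) e \<in> \<int>" for e
      using x lk0[of e x] lk1[of _ e x] by (cases "\<exists>i\<in>I. e \<in> g i") (auto simp: lattice_points_def)
    moreover have "e \<in> J" if "Poly_Mapping.lookup (f x) e \<noteq> 0" for e
      using lk0[of e x] g(2) that by blast
    ultimately show "f x \<in> lattice_points J" by (auto simp: lattice_points_def in_keys_iff)
  qed
  have "affine_isomorphism f (affine hull P) (affine hull Q)"
    unfolding affine_isomorphism_def bij_betw_def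
    using hull inj_on_subset[OF inj PW] lin by (auto simp: linear_add linear_scale)
  moreover have "bij_betw f (affine hull P \<inter> lattice_points I) (affine hull Q \<inter> lattice_points J)"
    unfolding bij_betw_def
  proof
    show "inj_on f (affine hull P \<inter> lattice_points I)"
      using inj PW by (auto intro: inj_on_subset)
    show "f ` (affine hull P \<inter> lattice_points I) = affine hull Q \<inter> lattice_points J"
      unfolding hull[symmetric] using lat PW by blast
  qed
  moreover have "lattice_polytope I P"
    unfolding P_def using I F(2) by (rule lattice_polytope_incidence_vectors)
  moreover have "lattice_polytope J Q"
    unfolding Q_def using J by (rule lattice_polytope_incidence_vectors) (use F(2) g(2) in blast)
  ultimately show ?thesis
    unfolding unimodular_equivalent_def P_def[symmetric] Q_def[symmetric] using I J fPQ by blast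
qed

section \<open>The polytopes of trees and cactus graphs\<close>

text \<open>Reduces equality of polytopes to equality of the families of sets that index their
  generators.\<close>

lemma setcompr_incidence_vector: "{incidence_vector (h x) |x. R x} = incidence_vector ` {h x |x. R x}"
  by blast

text \<open>A linear map commutes with convex hulls, so it suffices to match generators. The
  relabelling is injective since each block is determined by its one edge.\<close>

lemma tree_CBP_relabel:
  assumes "tree T"
  shows "relabel (\<lambda>B. the_elem (edges B)) (blocks T) ` CBP T = CSP T"
proof -
  let ?f = "\<lambda>B :: 'a graph. the_elem (edges B)"
  have b: "blocks T = (\<lambda>e. Graph e {e}) ` edges T" using tree_blocks[OF assms] .
  have fin: "finite (blocks T)" using finite_edges assms unfolding b by (auto simp: tree_def)
  have inj: "inj_on ?f (blocks T)" unfolding b by (auto simp: inj_on_def)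
  have "relabel ?f (blocks T) ` CBP T = convex hull
      (relabel ?f (blocks T) ` {incidence_vector A |A. A \<subseteq> blocks T \<and> graph_connected (graph_Union A)})"
    unfolding CBP_def by (rule convex_hull_linear_image[OF linear_relabel])
  also have "relabel ?f (blocks T) ` {incidence_vector A |A. A \<subseteq> blocks T \<and> graph_connected (graph_Union A)}
      = {incidence_vector (?f ` A) |A. A \<subseteq> blocks T \<and> graph_connected (graph_Union A)}"
    using relabel_incidence_vector[OF fin inj] by (auto simp: setcompr_eq_image image_image intro!: image_cong)
  also have "\<dots> = {incidence_vector (edges H) |H. subgraph H T \<and> graph_connected H}"
    unfolding setcompr_incidence_vector tree_connected_edge_sets[OF assms] ..
  finally show ?thesis by (simp add: CSP_def)
qed

theorem proposition3p1:
  fixes T :: "'a graph" and G :: "'b graph"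
  shows "(tree T \<longrightarrow>
           (\<forall>B\<in>blocks T. is_singleton (edges B)) \<and>
           bij_betw (\<lambda>B. the_elem (edges B)) (blocks T) (edges T) \<and>
           relabel (\<lambda>B. the_elem (edges B)) (blocks T) ` CBP T = CSP T)
       \<and> (is_graph G \<and> graph_connected G \<and> eulerian G \<and> cactus G \<longrightarrow>
           blocks G = cycles G \<and>
           ESP\<^sub>p G = CBP G \<and>
           unimodular_equivalent (blocks G) (CBP G) (edges G) (TECSP G) \<and>
           TECSP G = ESP G)"
proof (intro conjI impI)
  assume T: "tree T"
  show "\<forall>B\<in>blocks T. is_singleton (edges B)" by (auto simp: tree_blocks[OF T])
  show "bij_betw (\<lambda>B. the_elem (edges B)) (blocks T) (edges T)"
    by (auto simp: tree_blocks[OF T] bij_betw_def inj_on_def image_image)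
  show "relabel (\<lambda>B. the_elem (edges B)) (blocks T) ` CBP T = CSP T" using T by (rule tree_CBP_relabel)
next
  assume "is_graph G \<and> graph_connected G \<and> eulerian G \<and> cactus G"
  then have G: "is_graph G" "eulerian G" "cactus G" by auto
  let ?F = "{A. A \<subseteq> cycles G \<and> graph_connected (graph_Union A)}"
  show b: "blocks G = cycles G" using blocks_cactus eulerian_no_bridge G by blast
  have CBP: "CBP G = convex hull (incidence_vector ` ?F)"
    unfolding CBP_def b by (simp add: setcompr_eq_image)
  show "ESP\<^sub>p G = CBP G"
    unfolding CBP ESP\<^sub>p_def setcompr_incidence_vector cactus_eulerian_cycle_sets[OF G(3)] ..
  show TE: "TECSP G = ESP G"
    unfolding TECSP_def ESP_def setcompr_incidence_vector cactus_eulerian_edge_sets[OF G(3)] ..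
  \<comment> \<open>The edges of an Eulerian subgraph are exactly those of its cycles, so the
    generators of \<open>ESP G\<close> too can be indexed by \<open>?F\<close>.\<close>
  have "{edges H |H. subgraph H G \<and> eulerian H} =
      (\<lambda>A. \<Union>C\<in>A. edges C) ` {cycles H |H. subgraph H G \<and> eulerian H}"
    unfolding setcompr_eq_image image_image
    by (rule image_cong) (auto simp: subgraph_def dest: eulerian_edges)
  then have ESP: "ESP G = convex hull (incidence_vector ` (\<lambda>A. \<Union>C\<in>A. edges C) ` ?F)"
    unfolding ESP_def setcompr_incidence_vector cactus_eulerian_cycle_sets[OF G(3)] by simp
  \<comment> \<open>With \<open>TECSP G\<close> rewritten as \<open>ESP G\<close>, both polytopes
    are hulls over the same family \<open>?F\<close>, and each cycle stands for its edge
    set.\<close>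
  show "unimodular_equivalent (blocks G) (CBP G) (edges G) (TECSP G)"
    unfolding TE ESP CBP b
  proof (rule unimodular_equivalent_disjoint_unions)
    show "finite (cycles G)" "finite (edges G)" using G finite_cycles finite_edges by auto
    show "edges C \<noteq> {}" if "C \<in> cycles G" for C
      using that is_cycle_two_connected two_connected_has_edge by (fastforce simp: cycles_def subgraph_def)
    show "edges C \<subseteq> edges G" if "C \<in> cycles G" for C
      using that by (simp add: cycles_def subgraph_def)
    show "C = D" if "C \<in> cycles G" "D \<in> cycles G" "e \<in> edges C" "e \<in> edges D" for C D e
      using cactus_common_edge_eq G(3) that by blast
    \<comment> \<open>The empty union is the empty graph, connected by convention; it supplies the
      origin.\<close>
    show "{} \<in> ?F" by (simp add: graph_connected_def)
  qed simp
qed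

end
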